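(* Let $J\in\mathbb{R}$, $\beta>0$, let $\rho:\{-1,1\}\times\mathbb{R}\to\mathbb{R}$ be a function, and let $h:V\to\mathbb{R}$, $x\mapsto h_x$. The probability distributions $\zeta_n^{\bar P}(h,\cdot)$ on $\{-1,1\}^{V_n}$ given by $$\zeta_n^{\bar P}(h,\sigma_n)=\frac{1}{\mathbf{Z}_n^h}\exp\Big\{J\beta\sum_{\langle x,y\rangle,\ x,y\in V_n}\rho(\sigma_n(x),\sigma_n(y))+\sum_{x\in W_n}\rho(\sigma_n(x),h_x)\Big\}$$ are compatible if and only if for every $x\in V$ $$\prod_{y\in S(x)}\frac{\sum_{u\in\{-1,1\}}\exp\big(J\beta\rho(1,u)+\rho(u,h_y)\big)}{\sum_{u\in\{-1,1\}}\exp\big(J\beta\rho(-1,u)+\rho(u,h_y)\big)}=\exp\{\rho(1,h_x)-\rho(-1,h_x)\}.$$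
   Context: Let $V$ be the vertex set of the Cayley tree of order $k\ge1$, i.e. the infinite tree in which every vertex has exactly $k+1$ edges, with graph distance $d$. Fix a root $x^0\in V$ and put $W_n=\{x\in V:d(x,x^0)=n\}$ and $V_n=\bigcup_{m=0}^nW_m$ for $n\ge0$. For $x\in W_n$, $S(x)=\{y\in W_{n+1}: y \text{ adjacent to } x\}$ is the set of direct successors of $x$. The spin set is $\{-1,1\}$. In the sum over edges $\langle x,y\rangle$ with $x,y\in V_n$, each edge is counted once and written with $y\in S(x)$. $\mathbf{Z}_n^h$ is the normalizing constant, i.e. the sum over $\sigma_n\in\{-1,1\}^{V_n}$ of the exponential in the formula. The formula is used for all $n\ge0$ (for $n=0$ there are no edges). The distributions are compatible if for all $n\ge1$ and all $\sigma_{n-1}\in\{-1,1\}^{V_{n-1}}$, $$\sum_{\omega_n\in\{-1,1\}^{W_n}}\zeta_n^{\bar P}(h,\sigma_{n-1}\omega_n)=\zeta_{n-1}^{\bar P}(h,\sigma_{n-1}),$$ where $\sigma_{n-1}\omega_n\in\{-1,1\}^{V_n}$ equals $\sigma_{n-1}$ on $V_{n-1}$ and $\omega_n$ on $W_n$. *)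

theory Defs
  imports
    Complex_Main
    "HOL-Library.FuncSet"
    "Graph_Theory.Graph_Theory"
begin

(* An undirected simple graph is a loop-free pair digraph with a symmetric arc relation.
   In it every edge u-v yields the directed cycle u,v,u, so an undirected cycle is a
   library cycle with at least three arcs, and the library's notion of tree (which forbids
   all directed cycles) is not applicable.  The degree of a vertex is its out-degree. *)
locale cayley_tree = pair_bidirected_digraph G
  for G :: "'a pair_pre_digraph" +
  fixes k :: nat and x0 :: 'a
  assumes order_pos: "k \<ge> 1"
    and infinite_verts: "infinite (pverts G)"
    and connected_tree: "Digraph_Component.connected (with_proj G)"
    and acyclic_tree: "\<not> (\<exists>p. cycle p \<and> length p \<ge> 3)"
    and regular: "\<And>x. x \<in> pverts G \<Longrightarrow> out_degree (with_proj G) x = k + 1"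
    and root_in_verts: "x0 \<in> pverts G"
begin

text \<open>The graph distance is the shortest-path distance for unit arc weights.\<close>

definition W :: "nat \<Rightarrow> 'a set" where
  "W n = {x \<in> pverts G. \<mu> (\<lambda>_. 1) x x0 = ereal (real n)}"

definition V :: "nat \<Rightarrow> 'a set" where
  "V n = (\<Union>m\<in>{0..n}. W m)"

definition S :: "'a \<Rightarrow> 'a set" where
  "S x = {y. \<exists>n. x \<in> W n \<and> y \<in> W (n + 1) \<and> (x, y) \<in> parcs G}"

text \<open>Each undirected edge inside \<open>V n\<close> is represented by exactly one of its two arcs.\<close>

definition edges :: "nat \<Rightarrow> ('a \<times> 'a) set" where
  "edges n = {(x, y) \<in> parcs G. x \<in> V n \<and> y \<in> V n \<and> y \<in> S x}"

text \<open>Spins are the real numbers \<open>-1\<close> and \<open>1\<close>, since they occur as second arguments of \<open>\<rho>\<close>.\<close>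

definition configs :: "'a set \<Rightarrow> ('a \<Rightarrow> real) set" where
  "configs A = A \<rightarrow>\<^sub>E {-1, 1}"

definition weight ::
    "real \<Rightarrow> real \<Rightarrow> (real \<Rightarrow> real \<Rightarrow> real) \<Rightarrow> ('a \<Rightarrow> real) \<Rightarrow> nat \<Rightarrow> ('a \<Rightarrow> real) \<Rightarrow> real" where
  "weight J \<beta> \<rho> h n \<sigma> =
     exp (J * \<beta> * (\<Sum>(x, y)\<in>edges n. \<rho> (\<sigma> x) (\<sigma> y)) + (\<Sum>x\<in>W n. \<rho> (\<sigma> x) (h x)))"

definition Z ::
    "real \<Rightarrow> real \<Rightarrow> (real \<Rightarrow> real \<Rightarrow> real) \<Rightarrow> ('a \<Rightarrow> real) \<Rightarrow> nat \<Rightarrow> real" where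
  "Z J \<beta> \<rho> h n = (\<Sum>\<sigma>\<in>configs (V n). weight J \<beta> \<rho> h n \<sigma>)"

definition \<zeta> ::
    "real \<Rightarrow> real \<Rightarrow> (real \<Rightarrow> real \<Rightarrow> real) \<Rightarrow> ('a \<Rightarrow> real) \<Rightarrow> nat \<Rightarrow> ('a \<Rightarrow> real) \<Rightarrow> real" where
  "\<zeta> J \<beta> \<rho> h n \<sigma> = 1 / Z J \<beta> \<rho> h n * weight J \<beta> \<rho> h n \<sigma>"

text \<open>The concatenation of \<open>\<sigma>\<close> on \<open>V (n - 1)\<close> and \<open>\<omega>\<close> on \<open>W n\<close> is
  \<open>override_on \<sigma> \<omega> (W n)\<close>.\<close>

definition compatible ::
    "real \<Rightarrow> real \<Rightarrow> (real \<Rightarrow> real \<Rightarrow> real) \<Rightarrow> ('a \<Rightarrow> real) \<Rightarrow> bool" where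
  "compatible J \<beta> \<rho> h \<longleftrightarrow>
     (\<forall>n\<ge>1. \<forall>\<sigma>\<in>configs (V (n - 1)).
        (\<Sum>\<omega>\<in>configs (W n). \<zeta> J \<beta> \<rho> h n (override_on \<sigma> \<omega> (W n))) =
          \<zeta> J \<beta> \<rho> h (n - 1) \<sigma>)"

end

end

theory Submission
  imports Defs
begin

text \<open>
  Summing the weight of \<open>\<sigma>\<omega>\<close> over the spins \<open>\<omega>\<close> on \<open>W (n + 1)\<close> factorises over the vertices of
  \<open>W (n + 1)\<close>, because in a tree these are partitioned by the sets \<open>S x\<close> with \<open>x \<in> W n\<close>. Hence
  compatibility at level \<open>n + 1\<close> says that two product functions of \<open>\<sigma>\<close> on \<open>W n\<close> are proportional.
  Flipping the spin at a single \<open>x\<close> gives the ratio condition at \<open>x\<close>. Conversely, the ratio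
  conditions give proportionality factor by factor, and normalisation identifies the constant.
\<close>

section \<open>Gluing of configurations and comparison of products\<close>

text \<open>Restricting to \<open>A\<close> and to \<open>B\<close> is inverse to gluing with
  \<open>override_on\<close>; disjointness ensures that the values of \<open>\<sigma>\<close> on
  \<open>A\<close> are not overwritten.\<close>

lemma sum_PiE_Un:
  assumes "A \<inter> B = {}"
  shows "(\<Sum>\<tau>\<in>A \<union> B \<rightarrow>\<^sub>E C. F \<tau>) = (\<Sum>\<sigma>\<in>A \<rightarrow>\<^sub>E C. \<Sum>\<omega>\<in>B \<rightarrow>\<^sub>E C. F (override_on \<sigma> \<omega> B))"
proof -
  have join: "override_on (restrict \<tau> A) (restrict \<tau> B) B = \<tau>"
    "restrict \<tau> A \<in> A \<rightarrow>\<^sub>E C" "restrict \<tau> B \<in> B \<rightarrow>\<^sub>E C" if "\<tau> \<in> A \<union> B \<rightarrow>\<^sub>E C" for \<tau>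
    using that PiE_arb[OF that] by (auto simp: override_on_def restrict_def fun_eq_iff)
  have parts: "restrict (override_on \<sigma> \<omega> B) A = \<sigma>" "restrict (override_on \<sigma> \<omega> B) B = \<omega>"
    "override_on \<sigma> \<omega> B \<in> A \<union> B \<rightarrow>\<^sub>E C"
    if "\<sigma> \<in> A \<rightarrow>\<^sub>E C" "\<omega> \<in> B \<rightarrow>\<^sub>E C" for \<sigma> \<omega>
    using that assms PiE_arb[OF that(1)] PiE_arb[OF that(2)]
    by (auto simp: override_on_def restrict_def fun_eq_iff PiE_iff extensional_def)
  have "(\<Sum>\<tau>\<in>A \<union> B \<rightarrow>\<^sub>E C. F \<tau>)
      = (\<Sum>(\<sigma>, \<omega>)\<in>(A \<rightarrow>\<^sub>E C) \<times> (B \<rightarrow>\<^sub>E C). F (override_on \<sigma> \<omega> B))"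
    by (rule sum.reindex_bij_witness[where i = "\<lambda>(\<sigma>, \<omega>). override_on \<sigma> \<omega> B"
          and j = "\<lambda>\<tau>. (restrict \<tau> A, restrict \<tau> B)"])
      ((erule SigmaE)?; simp add: join parts del: restrict_PiE)+
  then show ?thesis
    by (simp add: sum.cartesian_product)
qed

text \<open>Changing \<open>\<sigma>\<close> only at \<open>x\<close> leaves all other factors
  fixed, so they cancel when the equations for \<open>s\<close> and \<open>t\<close> are
  divided.\<close>

lemma prod_ratio_at_point:
  fixes f g :: "'a \<Rightarrow> 'b \<Rightarrow> real"
  assumes "finite A" "x \<in> A"
    and nz: "\<And>z u. z \<in> A \<Longrightarrow> f z u \<noteq> 0" "\<And>z u. z \<in> A \<Longrightarrow> g z u \<noteq> 0"
    and eq: "\<And>u. u \<in> {s, t} \<Longrightarrow>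
      (\<Prod>z\<in>A. f z ((\<sigma>(x := u)) z)) = c * (\<Prod>z\<in>A. g z ((\<sigma>(x := u)) z))"
  shows "f x s / f x t = g x s / g x t"
proof -
  define P where "P = (\<Prod>z\<in>A - {x}. f z (\<sigma> z))"
  define Q where "Q = (\<Prod>z\<in>A - {x}. g z (\<sigma> z))"
  have eq': "f x u * P = c * (g x u * Q)" if "u \<in> {s, t}" for u
  proof -
    have "(\<Prod>z\<in>A - {x}. f z ((\<sigma>(x := u)) z)) = P" "(\<Prod>z\<in>A - {x}. g z ((\<sigma>(x := u)) z)) = Q"
      unfolding P_def Q_def by (auto intro: prod.cong)
    then show ?thesis
      using eq[OF that] unfolding prod.remove[OF assms(1,2)] by simp
  qed
  have "P \<noteq> 0"
    using nz assms(1) by (simp add: P_def)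
  then have scale: "f x u = (c * Q / P) * g x u" if "u \<in> {s, t}" for u
    using eq'[OF that] by (simp add: field_simps)
  have "c * Q / P \<noteq> 0"
    using scale[of s] nz(1)[OF assms(2), of s] by auto
  then show ?thesis
    using scale[of s] scale[of t] by simp
qed

context cayley_tree
begin

section \<open>Levels of the rooted tree via shortest walks\<close>

lemma awalk_cost_unit: "awalk_cost (\<lambda>_. 1) p = real (length p)"
  by (simp add: awalk_cost_def sum_list_triv)

text \<open>A shortest walk attains the infimum that defines \<open>\<mu>\<close>. This replaces
  extended real distances by lengths of walks.\<close>

lemma in_W_if_shortest:
  assumes "awalk x p x0" "\<And>q. awalk x q x0 \<Longrightarrow> length p \<le> length q"
  shows "x \<in> W (length p)"
proof -
  have "\<mu> (\<lambda>_. 1) x x0 = ereal (real (length p))"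
    unfolding \<mu>_def awalk_cost_unit
    by (rule antisym) (use assms in \<open>auto intro: INF_lower INF_greatest\<close>)
  then show ?thesis
    using assms(1) by (simp add: W_def awalk_hd_in_verts)
qed

lemma awalk_imp_shortest:
  assumes "awalk x p x0"
  obtains q where "awalk x q x0" "\<And>r. awalk x r x0 \<Longrightarrow> length q \<le> length r"
  using ex_has_least_nat[of "\<lambda>q. awalk x q x0" p length] assms by blast

lemma W_unique: "x \<in> W m \<Longrightarrow> x \<in> W n \<Longrightarrow> m = n"
  by (simp add: W_def)

lemma W_subset_verts: "W n \<subseteq> pverts G"
  by (auto simp: W_def)

lemma W_le_length:
  assumes "x \<in> W n" "awalk x p x0"
  shows "n \<le> length p"
  using min_cost_le_walk_cost[OF assms(2), of "\<lambda>_. 1"] assms(1) by (simp add: W_def awalk_cost_unit)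

lemma W_awalk:
  assumes "x \<in> W n"
  obtains p where "awalk x p x0" "length p = n"
proof -
  have "x \<rightarrow>\<^sup>*\<^bsub>with_proj G\<^esub> x0"
    using assms \<mu>_reach_conv[of "\<lambda>_. 1" x x0] by (simp add: W_def)
  then obtain p where "awalk x p x0"
    by (auto simp: reachable_awalk)
  then obtain q where q: "awalk x q x0" "\<And>r. awalk x r x0 \<Longrightarrow> length q \<le> length r"
    by (metis awalk_imp_shortest)
  show thesis
    by (rule that[OF q(1)]) (metis W_unique assms in_W_if_shortest q)
qed

text \<open>By connectedness every vertex has a finite distance from \<open>x0\<close>, so arguments
  made level by level reach all of \<open>pverts G\<close>.\<close>

lemma verts_in_W:
  assumes "x \<in> pverts G"
  obtains n where "x \<in> W n"
proof -
  have "x \<rightarrow>\<^sup>*\<^bsub>with_proj G\<^esub> x0"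
    using connected_tree assms root_in_verts reachable_mk_symmetric_eq[OF pair_sym_arcs]
    unfolding connected_def strongly_connected_def by simp
  then obtain p where "awalk x p x0"
    by (auto simp: reachable_awalk)
  then show thesis
    by (metis awalk_imp_shortest in_W_if_shortest that)
qed

lemma W_0: "W 0 = {x0}"
proof -
  have "x = x0" if "x \<in> W 0" for x
    using that by (metis W_awalk awalk_empty_ends length_0_conv)
  moreover have "x0 \<in> W (length ([] :: ('a \<times> 'a) list))"
    by (rule in_W_if_shortest) (auto simp: awalk_Nil_iff root_in_verts)
  ultimately show ?thesis
    by auto
qed

text \<open>The parent is the second vertex of a shortest walk to \<open>x0\<close>. The rest of
  that walk is again shortest, since a shorter one could be prolonged by the arc from
  \<open>y\<close>.\<close>

lemma W_Suc_parent:
  assumes "y \<in> W (Suc n)"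
  obtains x where "x \<in> W n" "(x, y) \<in> parcs G"
proof -
  obtain p where p: "awalk y p x0" "length p = Suc n"
    using W_awalk[OF assms] .
  then obtain x q where q: "p = (y, x) # q" "(y, x) \<in> parcs G" "awalk x q x0" "length q = n"
    by (cases p) (auto simp: awalk_Cons_iff)
  have "length q \<le> length r" if "awalk x r x0" for r
  proof -
    have "awalk y ((y, x) # r) x0"
      using that q(2) by (simp add: awalk_Cons_iff)
    then show ?thesis
      using W_le_length[OF assms] q(4) by fastforce
  qed
  then have "x \<in> W n"
    using in_W_if_shortest[OF q(3)] q(4) by blast
  then show thesis
    using that q(2) arcs_symmetric by blast
qed

lemma S_eq:
  assumes "x \<in> W n"
  shows "S x = {y \<in> W (Suc n). (x, y) \<in> parcs G}"
  using assms W_unique by (auto simp: S_def)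

lemma W_Suc: "W (Suc n) = (\<Union>x\<in>W n. S x)"
  using W_Suc_parent[of _ n] by (auto simp: S_eq)

lemma V_iff: "x \<in> V n \<longleftrightarrow> (\<exists>m\<le>n. x \<in> W m)"
  by (auto simp: V_def)

lemma W_subset_V: "W n \<subseteq> V n"
  by (auto simp: V_iff)

lemma V_Suc: "V (Suc n) = V n \<union> W (Suc n)"
  by (auto simp: V_iff le_Suc_eq)

lemma V_W_disjoint: "V n \<inter> W (Suc n) = {}"
  using W_unique by (fastforce simp: V_iff)

section \<open>Unique parents from acyclicity\<close>

text \<open>Climbing from both vertices to their parents until these coincide yields the path.
  Staying in \<open>V n\<close> is what later keeps a common successor off it.\<close>

lemma apath_within_V:
  assumes "x \<in> W n" "x' \<in> W n" "x \<noteq> x'"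
  shows "\<exists>p. apath x p x' \<and> set (pawalk_verts x p) \<subseteq> V n"
  using assms
proof (induction n arbitrary: x x')
  case 0
  then show ?case by (simp add: W_0)
next
  case (Suc n)
  obtain z z' where z: "z \<in> W n" "(z, x) \<in> parcs G" and z': "z' \<in> W n" "(z', x') \<in> parcs G"
    using W_Suc_parent Suc.prems by metis
  have "\<exists>p. apath z p z' \<and> set (pawalk_verts z p) \<subseteq> V n"
  proof (cases "z = z'")
    case True
    then show ?thesis
      using z(1) W_subset_verts by (intro exI[of _ "[]"]) (auto simp: apath_Nil_iff V_iff)
  qed (use Suc.IH z z' in blast)
  then obtain p where p: "apath z p z'" "set (pawalk_verts z p) \<subseteq> V n"
    by blast
  \<comment> \<open>Both end points lie outside \<open>V n\<close> and differ from each other, so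
    attaching them to a path in \<open>V n\<close> repeats no vertex.\<close>
  have notin: "x \<notin> V n" "x' \<notin> V n"
    using V_W_disjoint Suc.prems by auto
  have end_p: "last (pawalk_verts z p) = z'"
    using p(1) awalkI_apath awlast_of_awalk by force
  have "x' \<notin> set (pawalk_verts z p)" "z' \<noteq> x'"
    using p(2) notin z'(1) W_subset_V by blast+
  then have "apath z (p @ [(z', x')]) x'"
    using p z' notin end_p W_subset_verts[of "Suc n"] W_subset_verts[of n] Suc.prems(2)
    by (auto simp: apath_append_iff apath_simps)
  moreover have verts: "pawalk_verts z (p @ [(z', x')]) = pawalk_verts z p @ [x']"
    using awalk_verts_append[OF awalkI_apath[OF calculation]] end_p by simp
  ultimately have "apath x ((x, z) # p @ [(z', x')]) x'"
    using p(2) notin Suc.prems(3) z(2) arcs_symmetric by (auto simp: apath_Cons_iff)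
  moreover have "set (pawalk_verts x ((x, z) # p @ [(z', x')])) \<subseteq> V (Suc n)"
    using p(2) Suc.prems verts by (auto simp: V_Suc)
  ultimately show ?case
    by blast
qed

text \<open>A common successor \<open>y\<close> would close a path between \<open>x\<close> and
  \<open>x'\<close> inside \<open>V n\<close> to a cycle. This is where acyclicity of the tree
  enters.\<close>

lemma S_disjoint:
  assumes "x \<in> W n" "x' \<in> W n" "x \<noteq> x'"
  shows "S x \<inter> S x' = {}"
proof (rule ccontr)
  assume "S x \<inter> S x' \<noteq> {}"
  then obtain y where y: "y \<in> W (Suc n)" "(x, y) \<in> parcs G" "(x', y) \<in> parcs G"
    using assms by (auto simp: S_eq)
  obtain p where p: "apath x p x'" "set (pawalk_verts x p) \<subseteq> V n"
    using apath_within_V[OF assms] by blast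
  have "y \<notin> V n"
    using V_W_disjoint y(1) by auto
  have end_p: "last (pawalk_verts x p) = x'"
    using p(1) awalkI_apath awlast_of_awalk by force
  have walk: "awalk x (p @ [(x', y)]) y"
    using p(1) end_p y in_arcsD2 by (auto simp: apath_def awalk_simps)
  then have verts: "pawalk_verts x (p @ [(x', y)]) = pawalk_verts x p @ [y]"
    using awalk_verts_append[OF walk] end_p by simp
  have "cycle ((y, x) # p @ [(x', y)])"
    unfolding cycle_def
  proof (intro exI conjI)
    show "awalk y ((y, x) # p @ [(x', y)]) y"
      using walk y arcs_symmetric by (auto simp: awalk_Cons_iff)
    show "distinct (tl (pawalk_verts y ((y, x) # p @ [(x', y)])))"
      using verts p \<open>y \<notin> V n\<close> by (auto simp: apath_def)
  qed simp
  \<comment> \<open>A nonempty path between the two parents brings the cycle to at least three arcs,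
    so it is not just one edge traversed back and forth.\<close>
  moreover have "p \<noteq> []"
    using p(1) assms(3) by (auto simp: apath_Nil_iff)
  then have "length ((y, x) # p @ [(x', y)]) \<ge> 3"
    by (cases p) auto
  ultimately show False
    using acyclic_tree by blast
qed

section \<open>Finiteness and the decomposition of the edge set\<close>

lemma finite_S: "finite (S x)"
proof (cases "x \<in> pverts G")
  case True
  \<comment> \<open>An infinite set has cardinality 0, so the nonzero degree \<open>k + 1\<close>
    forces finiteness.\<close>
  then have "finite (out_arcs (with_proj G) x)"
    using regular[OF True] by (intro card_ge_0_finite) (simp add: out_degree_def)
  moreover have "S x \<subseteq> snd ` out_arcs (with_proj G) x"
    by (force simp: S_def out_arcs_def)
  ultimately show ?thesis
    by (metis finite_imageI finite_subset)
qed (auto simp: S_def W_def)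

lemma finite_W: "finite (W n)"
  by (induction n) (auto simp: W_0 W_Suc finite_S)

lemma finite_V: "finite (V n)"
  by (simp add: V_def finite_W)

text \<open>A parent at level \<open>m\<close> and its child at level \<open>m + 1\<close> both lie
  in \<open>V n\<close> exactly when \<open>m < n\<close>.\<close>

lemma edges_eq: "edges n = (\<Union>m<n. Sigma (W m) S)"
proof -
  have "(x, y) \<in> edges n \<longleftrightarrow> (\<exists>m<n. x \<in> W m \<and> y \<in> S x)" for x y
  proof (cases "y \<in> S x")
    case True
    then obtain m where m: "x \<in> W m" "y \<in> W (Suc m)" "(x, y) \<in> parcs G"
      by (auto simp: S_def)
    have "x \<in> V n \<longleftrightarrow> m \<le> n" "y \<in> V n \<longleftrightarrow> Suc m \<le> n"
      unfolding V_iff using m W_unique by blast+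
    moreover have "(\<exists>l<n. x \<in> W l) \<longleftrightarrow> m < n"
      using m(1) W_unique by blast
    ultimately show ?thesis
      using m(3) True by (auto simp: edges_def)
  qed (simp add: edges_def)
  then show ?thesis
    by auto
qed

lemma edges_Suc: "edges (Suc n) = edges n \<union> Sigma (W n) S"
  by (simp add: edges_eq lessThan_Suc Un_commute)

lemma edges_Sigma_disjoint: "edges n \<inter> Sigma (W n) S = {}"
  using W_unique by (fastforce simp: edges_eq)

lemma finite_edges: "finite (edges n)"
  by (rule finite_subset[of _ "V n \<times> V n"]) (auto simp: edges_def finite_V)

lemma finite_configs: "finite A \<Longrightarrow> finite (configs A)"
  by (simp add: configs_def finite_PiE)

section \<open>Factorisation of the summed weights\<close>

text \<open>Contribution of \<open>y\<close> once its own spin is summed out, when its parent has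
  spin \<open>s\<close>. For \<open>s = 1\<close> and \<open>s = -1\<close> it is the numerator and
  the denominator in the ratio condition.\<close>

definition branch_sum ::
    "real \<Rightarrow> real \<Rightarrow> (real \<Rightarrow> real \<Rightarrow> real) \<Rightarrow> ('a \<Rightarrow> real) \<Rightarrow> 'a \<Rightarrow> real \<Rightarrow> real" where
  "branch_sum J \<beta> \<rho> h y s = (\<Sum>u\<in>{-1, 1}. exp (J * \<beta> * \<rho> s u + \<rho> u (h y)))"

lemma branch_sum_pos: "branch_sum J \<beta> \<rho> h y s > 0"
  by (simp add: branch_sum_def add_pos_pos)

text \<open>The interaction inside \<open>V n\<close>, which occurs in the weights of both levels
  \<open>n\<close> and \<open>n + 1\<close> and therefore cancels from compatibility.\<close>

definition bulk_weight ::
    "real \<Rightarrow> real \<Rightarrow> (real \<Rightarrow> real \<Rightarrow> real) \<Rightarrow> nat \<Rightarrow> ('a \<Rightarrow> real) \<Rightarrow> real" where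
  "bulk_weight J \<beta> \<rho> n \<sigma> = exp (J * \<beta> * (\<Sum>(x, y)\<in>edges n. \<rho> (\<sigma> x) (\<sigma> y)))"

lemma weight_factor:
  "weight J \<beta> \<rho> h n \<sigma> = bulk_weight J \<beta> \<rho> n \<sigma> * (\<Prod>x\<in>W n. exp (\<rho> (\<sigma> x) (h x)))"
  by (simp add: weight_def bulk_weight_def exp_add exp_sum finite_W)

text \<open>New edges and new boundary vertices are both indexed by pairs of \<open>x\<close> in
  \<open>W n\<close> and \<open>y\<close> in \<open>S x\<close>, so each boundary term merges with
  the edge leading to its vertex.\<close>

lemma weight_Suc_override:
  "weight J \<beta> \<rho> h (Suc n) (override_on \<sigma> \<omega> (W (Suc n))) =
    bulk_weight J \<beta> \<rho> n \<sigma> *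
    (\<Prod>x\<in>W n. \<Prod>y\<in>S x. exp (J * \<beta> * \<rho> (\<sigma> x) (\<omega> y) + \<rho> (\<omega> y) (h y)))"
proof -
  let ?\<tau> = "override_on \<sigma> \<omega> (W (Suc n))"
  have old: "?\<tau> x = \<sigma> x" if "x \<in> V n" for x
    using that V_W_disjoint by (auto simp: override_on_def)
  have "(\<Sum>(x, y)\<in>edges n. \<rho> (?\<tau> x) (?\<tau> y)) = (\<Sum>(x, y)\<in>edges n. \<rho> (\<sigma> x) (\<sigma> y))"
    by (intro sum.cong) (auto simp: old edges_def)
  moreover have "(\<Sum>(x, y)\<in>Sigma (W n) S. \<rho> (?\<tau> x) (?\<tau> y)) = (\<Sum>x\<in>W n. \<Sum>y\<in>S x. \<rho> (\<sigma> x) (\<omega> y))"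
    unfolding sum.Sigma[OF finite_W ballI[OF finite_S], symmetric]
    by (intro sum.cong) (auto simp: old subsetD[OF W_subset_V] S_eq)
  moreover have "(\<Sum>y\<in>W (Suc n). \<rho> (?\<tau> y) (h y)) = (\<Sum>x\<in>W n. \<Sum>y\<in>S x. \<rho> (\<omega> y) (h y))"
  proof -
    have "(\<Sum>y\<in>W (Suc n). \<rho> (?\<tau> y) (h y)) = (\<Sum>y\<in>(\<Union>x\<in>W n. S x). \<rho> (\<omega> y) (h y))"
      by (rule sum.cong[OF W_Suc]) (simp add: W_Suc)
    also have "\<dots> = (\<Sum>x\<in>W n. \<Sum>y\<in>S x. \<rho> (\<omega> y) (h y))"
      by (rule sum.UNION_disjoint) (use finite_W finite_S S_disjoint in auto)
    finally show ?thesis .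
  qed
  ultimately have "weight J \<beta> \<rho> h (Suc n) ?\<tau> =
      exp (J * \<beta> * (\<Sum>(x, y)\<in>edges n. \<rho> (\<sigma> x) (\<sigma> y)) +
        (J * \<beta> * (\<Sum>x\<in>W n. \<Sum>y\<in>S x. \<rho> (\<sigma> x) (\<omega> y)) + (\<Sum>x\<in>W n. \<Sum>y\<in>S x. \<rho> (\<omega> y) (h y))))"
    by (simp add: weight_def edges_Suc sum.union_disjoint[OF finite_edges _ edges_Sigma_disjoint]
        finite_W finite_S distrib_left)
  also have "J * \<beta> * (\<Sum>x\<in>W n. \<Sum>y\<in>S x. \<rho> (\<sigma> x) (\<omega> y)) + (\<Sum>x\<in>W n. \<Sum>y\<in>S x. \<rho> (\<omega> y) (h y)) =
      (\<Sum>x\<in>W n. \<Sum>y\<in>S x. J * \<beta> * \<rho> (\<sigma> x) (\<omega> y) + \<rho> (\<omega> y) (h y))"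
    by (simp add: sum.distrib sum_distrib_left)
  finally show ?thesis
    \<comment> \<open>Only the sum over \<open>edges n\<close> is split off; each summand of the
      double sum stays whole and becomes one exponential per child.\<close>
    unfolding exp_add[of "J * \<beta> * sum _ _"]
    by (simp add: bulk_weight_def exp_sum finite_W finite_S)
qed

text \<open>With \<open>\<sigma>\<close> fixed, each factor depends on the spin of one vertex of
  \<open>W (Suc n)\<close> only, so the sum over all \<open>\<omega>\<close> becomes a product of
  sums over single spins.\<close>

lemma sum_weight_Suc:
  "(\<Sum>\<omega>\<in>configs (W (Suc n)). weight J \<beta> \<rho> h (Suc n) (override_on \<sigma> \<omega> (W (Suc n)))) =
    bulk_weight J \<beta> \<rho> n \<sigma> * (\<Prod>x\<in>W n. \<Prod>y\<in>S x. branch_sum J \<beta> \<rho> h y (\<sigma> x))"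
proof -
  \<comment> \<open>Disjointness of the sets \<open>S x\<close> makes the parent unique. It turns
    the double product into a single one over \<open>W (Suc n)\<close>, where sum and product can be
    exchanged.\<close>
  define parent where "parent y = (THE x. x \<in> W n \<and> y \<in> S x)" for y
  have parent: "parent y = x" if "x \<in> W n" "y \<in> S x" for x y
    unfolding parent_def using that S_disjoint by blast
  have flat: "(\<Prod>x\<in>W n. \<Prod>y\<in>S x. F y (\<sigma> x)) = (\<Prod>y\<in>W (Suc n). F y (\<sigma> (parent y)))"
    for F :: "'a \<Rightarrow> real \<Rightarrow> real"
  proof -
    have "(\<Prod>x\<in>W n. \<Prod>y\<in>S x. F y (\<sigma> x)) = (\<Prod>x\<in>W n. \<Prod>y\<in>S x. F y (\<sigma> (parent y)))"
      by (intro prod.cong refl) (simp add: parent)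
    also have "\<dots> = (\<Prod>y\<in>(\<Union>x\<in>W n. S x). F y (\<sigma> (parent y)))"
      by (rule prod.UNION_disjoint[symmetric]) (use finite_W finite_S S_disjoint in auto)
    finally show ?thesis
      by (simp add: W_Suc)
  qed
  have "(\<Prod>y\<in>W (Suc n). branch_sum J \<beta> \<rho> h y (\<sigma> (parent y))) =
      (\<Sum>\<omega>\<in>configs (W (Suc n)). \<Prod>y\<in>W (Suc n).
        exp (J * \<beta> * \<rho> (\<sigma> (parent y)) (\<omega> y) + \<rho> (\<omega> y) (h y)))"
    unfolding branch_sum_def configs_def by (rule prod_sum_PiE) (auto simp: finite_W)
  moreover have "weight J \<beta> \<rho> h (Suc n) (override_on \<sigma> \<omega> (W (Suc n))) = bulk_weight J \<beta> \<rho> n \<sigma> *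
      (\<Prod>y\<in>W (Suc n). exp (J * \<beta> * \<rho> (\<sigma> (parent y)) (\<omega> y) + \<rho> (\<omega> y) (h y)))" for \<omega>
    unfolding weight_Suc_override flat[of "\<lambda>y s. exp (J * \<beta> * \<rho> s (\<omega> y) + \<rho> (\<omega> y) (h y))"] ..
  ultimately show ?thesis
    by (simp add: flat[of "branch_sum J \<beta> \<rho> h"] sum_distrib_left)
qed

lemma Z_Suc:
  "Z J \<beta> \<rho> h (Suc n) =
    (\<Sum>\<sigma>\<in>configs (V n). \<Sum>\<omega>\<in>configs (W (Suc n)).
      weight J \<beta> \<rho> h (Suc n) (override_on \<sigma> \<omega> (W (Suc n))))"
  unfolding Z_def configs_def V_Suc by (rule sum_PiE_Un[OF V_W_disjoint])

lemma Z_pos: "Z J \<beta> \<rho> h n > 0"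
  unfolding Z_def
proof (rule sum_pos)
  show "configs (V n) \<noteq> {}"
    by (simp add: configs_def PiE_eq_empty_iff)
qed (simp_all add: finite_configs finite_V weight_def)

section \<open>Compatibility, proportionality and the ratio condition\<close>

text \<open>After the summation both sides carry the nonzero \<open>bulk_weight\<close>; cancelling
  it leaves a relation between functions of the spins on \<open>W n\<close>, with a constant
  independent of \<open>\<sigma>\<close>.\<close>

lemma compatible_iff_proportional:
  "compatible J \<beta> \<rho> h \<longleftrightarrow>
    (\<forall>n. \<forall>\<sigma>\<in>configs (V n).
      (\<Prod>x\<in>W n. \<Prod>y\<in>S x. branch_sum J \<beta> \<rho> h y (\<sigma> x)) =
        Z J \<beta> \<rho> h (Suc n) / Z J \<beta> \<rho> h n * (\<Prod>x\<in>W n. exp (\<rho> (\<sigma> x) (h x))))"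
proof -
  have "compatible J \<beta> \<rho> h \<longleftrightarrow>
    (\<forall>n. \<forall>\<sigma>\<in>configs (V n).
      (\<Sum>\<omega>\<in>configs (W (Suc n)). \<zeta> J \<beta> \<rho> h (Suc n) (override_on \<sigma> \<omega> (W (Suc n)))) =
        \<zeta> J \<beta> \<rho> h n \<sigma>)"
    unfolding compatible_def by (metis Suc_le_D diff_Suc_1 le_add1 plus_1_eq_Suc One_nat_def)
  moreover have "(\<Sum>\<omega>\<in>configs (W (Suc n)). \<zeta> J \<beta> \<rho> h (Suc n) (override_on \<sigma> \<omega> (W (Suc n)))) =
        \<zeta> J \<beta> \<rho> h n \<sigma> \<longleftrightarrow>
      (\<Prod>x\<in>W n. \<Prod>y\<in>S x. branch_sum J \<beta> \<rho> h y (\<sigma> x)) =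
        Z J \<beta> \<rho> h (Suc n) / Z J \<beta> \<rho> h n * (\<Prod>x\<in>W n. exp (\<rho> (\<sigma> x) (h x)))" for n \<sigma>
  proof -
    have "bulk_weight J \<beta> \<rho> n \<sigma> \<noteq> 0" "Z J \<beta> \<rho> h n \<noteq> 0" "Z J \<beta> \<rho> h (Suc n) \<noteq> 0"
      using Z_pos by (simp_all add: bulk_weight_def less_imp_neq[symmetric])
    then show ?thesis
      unfolding \<zeta>_def sum_distrib_left[symmetric] sum_weight_Suc weight_factor[of _ _ _ _ n]
      by (simp add: field_simps)
  qed
  ultimately show ?thesis
    by simp
qed

text \<open>Two configurations that differ only at \<open>x\<close> obey the proportionality with
  the same constant, so division isolates the factors of \<open>x\<close>.\<close>

lemma compatible_imp_ratio:
  assumes "compatible J \<beta> \<rho> h" "x \<in> W n" "s \<in> {-1, 1}" "t \<in> {-1, 1}"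
  shows "(\<Prod>y\<in>S x. branch_sum J \<beta> \<rho> h y s / branch_sum J \<beta> \<rho> h y t) =
    exp (\<rho> s (h x) - \<rho> t (h x))"
proof -
  \<comment> \<open>An arbitrary background; changing it at \<open>x\<close>, which lies in
    \<open>V n\<close>, gives again a configuration on \<open>V n\<close>.\<close>
  define \<sigma> :: "'a \<Rightarrow> real" where "\<sigma> = (\<lambda>z\<in>V n. 1)"
  have "\<sigma>(x := u) \<in> configs (V n)" if "u \<in> {s, t}" for u
    using that assms(2-4) by (auto simp: \<sigma>_def configs_def V_iff PiE_iff extensional_def)
  then have "(\<Prod>y\<in>S x. branch_sum J \<beta> \<rho> h y s) / (\<Prod>y\<in>S x. branch_sum J \<beta> \<rho> h y t) =
      exp (\<rho> s (h x)) / exp (\<rho> t (h x))"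
    using assms(1)
    by (intro prod_ratio_at_point[where A = "W n" and \<sigma> = \<sigma>
          and f = "\<lambda>z u. \<Prod>y\<in>S z. branch_sum J \<beta> \<rho> h y u" and g = "\<lambda>z u. exp (\<rho> u (h z))"
          and c = "Z J \<beta> \<rho> h (Suc n) / Z J \<beta> \<rho> h n"])
      (simp_all add: finite_W assms(2) finite_S branch_sum_pos less_imp_neq[symmetric]
        compatible_iff_proportional del: fun_upd_apply)
  then show ?thesis
    by (simp add: prod_dividef exp_diff)
qed

lemma ratio_imp_compatible:
  assumes "\<And>x. x \<in> pverts G \<Longrightarrow>
    (\<Prod>y\<in>S x. branch_sum J \<beta> \<rho> h y 1 / branch_sum J \<beta> \<rho> h y (-1)) =
      exp (\<rho> 1 (h x) - \<rho> (-1) (h x))"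
  shows "compatible J \<beta> \<rho> h"
proof -
  \<comment> \<open>The factor is fixed by spin 1; the ratio condition says that spin -1 gives the
    same one.\<close>
  define a where "a x = (\<Prod>y\<in>S x. branch_sum J \<beta> \<rho> h y 1) / exp (\<rho> 1 (h x))" for x
  have a: "(\<Prod>y\<in>S x. branch_sum J \<beta> \<rho> h y s) = a x * exp (\<rho> s (h x))"
    if "x \<in> pverts G" "s \<in> {-1, 1}" for x s
  proof -
    have "(\<Prod>y\<in>S x. branch_sum J \<beta> \<rho> h y (-1)) > 0"
      by (intro prod_pos) (simp add: branch_sum_pos)
    then show ?thesis
      using assms[OF that(1)] that(2) by (auto simp: a_def prod_dividef exp_diff field_simps)
  qed
  have proportional: "(\<Prod>x\<in>W n. \<Prod>y\<in>S x. branch_sum J \<beta> \<rho> h y (\<sigma> x)) =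
      (\<Prod>x\<in>W n. a x) * (\<Prod>x\<in>W n. exp (\<rho> (\<sigma> x) (h x)))"
    if "\<sigma> \<in> configs (V n)" for n \<sigma>
  proof -
    have "\<sigma> x \<in> {-1, 1}" if "x \<in> W n" for x
      using that \<open>\<sigma> \<in> configs (V n)\<close> by (auto simp: configs_def V_iff PiE_iff)
    then show ?thesis
      unfolding prod.distrib[symmetric] using W_subset_verts by (intro prod.cong refl a) auto
  qed
  \<comment> \<open>Summing the proportionality, weighted by \<open>bulk_weight\<close>, over all
    \<open>\<sigma>\<close> identifies the product of the \<open>a x\<close> with the quotient of
    consecutive normalising constants.\<close>
  have "Z J \<beta> \<rho> h (Suc n) = (\<Prod>x\<in>W n. a x) * Z J \<beta> \<rho> h n" for n
    unfolding Z_Suc sum_weight_Suc Z_def[of _ _ _ _ n] weight_factor[of _ _ _ _ n] sum_distrib_left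
    by (intro sum.cong refl) (simp add: proportional)
  then have "Z J \<beta> \<rho> h (Suc n) / Z J \<beta> \<rho> h n = (\<Prod>x\<in>W n. a x)" for n
    using Z_pos[of J \<beta> \<rho> h n] by simp
  then show ?thesis
    by (simp add: compatible_iff_proportional proportional)
qed

end

theorem theorem3:
  fixes G :: "'a pair_pre_digraph" and k :: nat and x0 :: 'a
    and J \<beta> :: real and \<rho> :: "real \<Rightarrow> real \<Rightarrow> real" and h :: "'a \<Rightarrow> real"
  assumes "cayley_tree G k x0"
    and "\<beta> > 0"
  shows "cayley_tree.compatible G x0 J \<beta> \<rho> h \<longleftrightarrow>
    (\<forall>x\<in>pverts G.
      (\<Prod>y\<in>cayley_tree.S G x0 x.
         (\<Sum>u\<in>{-1, 1}. exp (J * \<beta> * \<rho> 1 u + \<rho> u (h y))) /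
         (\<Sum>u\<in>{-1, 1}. exp (J * \<beta> * \<rho> (-1) u + \<rho> u (h y)))) =
      exp (\<rho> 1 (h x) - \<rho> (-1) (h x)))"
proof -
  interpret cayley_tree G k x0
    by fact
  show ?thesis
  proof
    assume c: "compatible J \<beta> \<rho> h"
    show "\<forall>x\<in>pverts G.
      (\<Prod>y\<in>S x. (\<Sum>u\<in>{-1, 1}. exp (J * \<beta> * \<rho> 1 u + \<rho> u (h y))) /
         (\<Sum>u\<in>{-1, 1}. exp (J * \<beta> * \<rho> (-1) u + \<rho> u (h y)))) =
      exp (\<rho> 1 (h x) - \<rho> (-1) (h x))"
    proof
      fix x
      assume "x \<in> pverts G"
      then obtain n where "x \<in> W n"
        by (rule verts_in_W)
      from compatible_imp_ratio[OF c this, of 1 "-1", unfolded branch_sum_def]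
      show "(\<Prod>y\<in>S x. (\<Sum>u\<in>{-1, 1}. exp (J * \<beta> * \<rho> 1 u + \<rho> u (h y))) /
           (\<Sum>u\<in>{-1, 1}. exp (J * \<beta> * \<rho> (-1) u + \<rho> u (h y)))) =
        exp (\<rho> 1 (h x) - \<rho> (-1) (h x))"
        by blast
    qed
  next
    assume "\<forall>x\<in>pverts G.
      (\<Prod>y\<in>S x. (\<Sum>u\<in>{-1, 1}. exp (J * \<beta> * \<rho> 1 u + \<rho> u (h y))) /
         (\<Sum>u\<in>{-1, 1}. exp (J * \<beta> * \<rho> (-1) u + \<rho> u (h y)))) =
      exp (\<rho> 1 (h x) - \<rho> (-1) (h x))"
    then show "compatible J \<beta> \<rho> h"
      by (intro ratio_imp_compatible) (unfold branch_sum_def, blast)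
  qed
qed

end
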